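(* Let $F_2$ be a free group of rank two with basis $\{x,y\}$. Then any primitive element of $F_2$ is a product of at most two palindromes in letters $x,y$.
   Context: An element of a free group $F$ is primitive if it belongs to some basis (free generating set) of $F$. Palindromes: let $F$ be a free group with basis $X$. An element $w\in F$ is a palindrome in letters $X$ if its reduced word $w=x_{i_1}x_{i_2}\cdots x_{i_k}$ (with $x_{i_j}\in X^{\pm1}$ and $x_{i_j}x_{i_{j+1}}\neq 1$ for all $j$) satisfies $x_{i_1}x_{i_2}\cdots x_{i_k}=x_{i_k}\cdots x_{i_2}x_{i_1}$, i.e. the reduced word reads the same left-to-right and right-to-left as a word in letters from $X^{\pm 1}$. The empty word (the identity) counts as a palindrome. *)

theory Defs
  imports "HOL-Algebra.Group"
begin

text \<open>
  A letter \<open>(a, True)\<close> stands for \<open>a\<close> and \<open>(a, False)\<close> for its inverse. The letters are formal: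
  with the group elements \<open>a\<close> and \<open>inv a\<close> themselves as letters, an involution would be its own
  inverse letter, and the group of order two would count as free on its generator.
\<close>

type_synonym 'a word = "('a \<times> bool) list"

definition words_on :: "'a set \<Rightarrow> 'a word set" where
  "words_on X = {u. fst ` set u \<subseteq> X}"

definition reduced :: "'a word \<Rightarrow> bool" where
  "reduced u \<longleftrightarrow> successively (\<lambda>(a, s) (b, t). \<not> (a = b \<and> s \<noteq> t)) u"

definition list_mult :: "('a, 'm) monoid_scheme \<Rightarrow> 'a list \<Rightarrow> 'a" where
  "list_mult G gs = foldr (\<lambda>g h. g \<otimes>\<^bsub>G\<^esub> h) gs \<one>\<^bsub>G\<^esub>"

definition letter_value :: "('a, 'm) monoid_scheme \<Rightarrow> 'a \<times> bool \<Rightarrow> 'a" where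
  "letter_value G l = (if snd l then fst l else inv\<^bsub>G\<^esub> (fst l))"

definition word_value :: "('a, 'm) monoid_scheme \<Rightarrow> 'a word \<Rightarrow> 'a" where
  "word_value G u = list_mult G (map (letter_value G) u)"

text \<open>
  \<open>X\<close> is a free generating set of \<open>G\<close>: every element of \<open>G\<close> is represented by
  exactly one reduced word in letters from \<open>X\<close> and their inverses.
\<close>

definition free_basis :: "('a, 'm) monoid_scheme \<Rightarrow> 'a set \<Rightarrow> bool" where
  "free_basis G X \<longleftrightarrow>
     X \<subseteq> carrier G \<and>
     bij_betw (word_value G) {u \<in> words_on X. reduced u} (carrier G)"

definition primitive :: "('a, 'm) monoid_scheme \<Rightarrow> 'a \<Rightarrow> bool" where
  "primitive G g \<longleftrightarrow> (\<exists>B. free_basis G B \<and> g \<in> B)"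

definition palindrome :: "('a, 'm) monoid_scheme \<Rightarrow> 'a set \<Rightarrow> 'a \<Rightarrow> bool" where
  "palindrome G X g \<longleftrightarrow>
     (\<exists>u \<in> words_on X. reduced u \<and> word_value G u = g \<and> rev u = u)"

end

theory Submission
  imports Defs "HOL-Algebra.Generated_Groups" "HOL-Library.Sublist"
begin

text \<open>
  Reading words backwards is an anti-automorphism of \<open>F\<^sub>2\<close> whose fixed points are the palindromes.
  Call a pair \<open>(a, b)\<close> reversible if \<open>u\<close>, \<open>u a\<close> and \<open>u b\<close> are palindromes for some \<open>u\<close>. This property
  is preserved by exchanging and inverting the entries, by \<open>(a, b) \<mapsto> (a b, b)\<close>, which turns \<open>u\<close> into
  \<open>u b\<close>, and by simultaneous conjugation. These moves reduce every generating pair to \<open>{x, y}\<close> up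
  to inverses, where \<open>u = 1\<close> works: a pair of minimal total length has no letter that both
  neighbours in a reduced word cancel completely, so that the length of a word in \<open>a\<close> and \<open>b\<close> is at
  most that of its value, and \<open>x\<close> and \<open>y\<close> can only be words of length one. A basis has at most two
  elements, so a primitive \<open>w\<close> lies in a generating pair, and \<open>w = u\<^sup>-\<^sup>1 (u w)\<close>.
\<close>

section \<open>Words\<close>

definition letter_inv :: "'a \<times> bool \<Rightarrow> 'a \<times> bool" where
  "letter_inv l = (fst l, \<not> snd l)"

definition word_inv :: "'a word \<Rightarrow> 'a word" where
  "word_inv u = rev (map letter_inv u)"

lemma fst_letter_inv [simp]: "fst (letter_inv l) = fst l"
  and letter_inv_letter_inv [simp]: "letter_inv (letter_inv l) = l"
  and letter_inv_neq [simp]: "letter_inv l \<noteq> l" "l \<noteq> letter_inv l"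
  by (auto simp: letter_inv_def prod_eq_iff)

lemma reduced_iff_successively: "reduced u \<longleftrightarrow> successively (\<lambda>l m. m \<noteq> letter_inv l) u"
  unfolding reduced_def
  by (rule arg_cong[where f = "\<lambda>R. successively R u"]) (auto simp: fun_eq_iff letter_inv_def)

lemma reduced_Nil [simp]: "reduced []"
  and reduced_singleton [simp]: "reduced [l]"
  and reduced_Cons_Cons [simp]: "reduced (l # m # u) \<longleftrightarrow> m \<noteq> letter_inv l \<and> reduced (m # u)"
  by (simp_all add: reduced_iff_successively)

lemma reduced_append_iff:
  "reduced (u @ v) \<longleftrightarrow> reduced u \<and> reduced v \<and> (u = [] \<or> v = [] \<or> hd v \<noteq> letter_inv (last u))"
  by (auto simp: reduced_iff_successively successively_append_iff)

lemma reduced_rev [simp]: "reduced (rev u) \<longleftrightarrow> reduced u"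
  unfolding reduced_iff_successively successively_rev
  by (rule arg_cong[where f = "\<lambda>R. successively R u"]) (auto simp: fun_eq_iff)

lemma reduced_word_inv [simp]: "reduced (word_inv u) \<longleftrightarrow> reduced u"
proof -
  have "(letter_inv l \<noteq> m) = (l \<noteq> letter_inv m)" for l m :: "'a \<times> bool"
    by auto
  then show ?thesis
    by (simp add: word_inv_def reduced_iff_successively successively_map eq_commute)
qed

lemma not_reduced_imp_cancel:
  assumes "\<not> reduced u"
  obtains p l q where "u = p @ l # letter_inv l # q"
  using assms
proof (induction u arbitrary: thesis rule: induct_list012)
  case (3 l m u)
  show ?case
  proof (cases "m = letter_inv l")
    case True
    with "3.prems"(1)[of "[]" l u] show ?thesis by simp
  next
    case False
    with "3.prems"(2) have "\<not> reduced (m # u)" by simp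
    then obtain p k q where "m # u = p @ k # letter_inv k # q"
      using "3.IH"(2) by blast
    with "3.prems"(1)[of "l # p" k q] show ?thesis by simp
  qed
qed auto

lemma words_on_Nil [simp]: "[] \<in> words_on X"
  and words_on_Cons [simp]: "l # u \<in> words_on X \<longleftrightarrow> fst l \<in> X \<and> u \<in> words_on X"
  and words_on_append [simp]: "u @ v \<in> words_on X \<longleftrightarrow> u \<in> words_on X \<and> v \<in> words_on X"
  and words_on_rev [simp]: "rev u \<in> words_on X \<longleftrightarrow> u \<in> words_on X"
  and words_on_word_inv [simp]: "word_inv u \<in> words_on X \<longleftrightarrow> u \<in> words_on X"
  by (auto simp: words_on_def word_inv_def image_image)

lemma words_on_mono: "u \<in> words_on X \<Longrightarrow> X \<subseteq> Y \<Longrightarrow> u \<in> words_on Y"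
  by (auto simp: words_on_def)

lemma length_word_inv [simp]: "length (word_inv u) = length u"
  by (simp add: word_inv_def)

lemma last_word_inv: "u \<noteq> [] \<Longrightarrow> last (word_inv u) = letter_inv (hd u)"
  by (simp add: word_inv_def last_rev hd_map)

lemma word_value_Nil [simp]: "word_value G [] = \<one>\<^bsub>G\<^esub>"
  and word_value_Cons: "word_value G (l # u) = letter_value G l \<otimes>\<^bsub>G\<^esub> word_value G u"
  by (simp_all add: word_value_def list_mult_def)

lemma longest_common_prefix_commute: "longest_common_prefix u v = longest_common_prefix v u"
  by (induction u v rule: longest_common_prefix.induct) auto

lemma longest_common_prefix_maximal:
  "\<exists>p u' v'. p = longest_common_prefix u v \<and> u = p @ u' \<and> v = p @ v' \<and>
    (u' = [] \<or> v' = [] \<or> hd u' \<noteq> hd v')"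
  by (induction u v rule: longest_common_prefix.induct) auto

text \<open>In this form, lower bounds on common prefixes become equalities of initial segments,
  which can be chained by transitivity.\<close>

lemma le_length_longest_common_prefix_iff:
  "n \<le> length (longest_common_prefix u v) \<longleftrightarrow>
    n \<le> length u \<and> n \<le> length v \<and> take n u = take n v"
proof (induction u v arbitrary: n rule: longest_common_prefix.induct)
  case (1 a u b v)
  then show ?case by (cases n) auto
qed auto

context group
begin

lemma letter_value_closed [simp]:
  "fst l \<in> carrier G \<Longrightarrow> letter_value G l \<in> carrier G"
  by (simp add: letter_value_def)

lemma letter_value_inv [simp]:
  "fst l \<in> carrier G \<Longrightarrow> letter_value G (letter_inv l) = inv (letter_value G l)"
  by (simp add: letter_value_def letter_inv_def)

lemma word_value_closed [simp]:
  "u \<in> words_on (carrier G) \<Longrightarrow> word_value G u \<in> carrier G"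
  by (induction u) (auto simp: word_value_Cons)

lemma word_value_singleton [simp]:
  "fst l \<in> carrier G \<Longrightarrow> word_value G [l] = letter_value G l"
  by (simp add: word_value_Cons)

lemma word_value_append:
  "u \<in> words_on (carrier G) \<Longrightarrow> v \<in> words_on (carrier G) \<Longrightarrow>
    word_value G (u @ v) = word_value G u \<otimes> word_value G v"
  by (induction u) (auto simp: word_value_Cons m_assoc)

lemma word_value_word_inv:
  "u \<in> words_on (carrier G) \<Longrightarrow> word_value G (word_inv u) = inv (word_value G u)"
proof (induction u)
  case (Cons l u)
  have "word_inv (l # u) = word_inv u @ [letter_inv l]"
    by (simp add: word_inv_def)
  with Cons show ?case
    by (simp add: word_value_append word_value_Cons inv_mult_group)
qed (simp add: word_inv_def)

lemma word_value_cancel: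
  assumes "p @ l # letter_inv l # q \<in> words_on (carrier G)"
  shows "word_value G (p @ l # letter_inv l # q) = word_value G (p @ q)"
  using assms by (simp add: word_value_append word_value_Cons m_assoc[symmetric])

text \<open>Deleting an adjacent inverse pair shortens the word, so induction on length ends at a
  reduced word. The arbitrary \<open>f\<close> stands for any quantity that such deletions preserve;
  it keeps its value on the way.\<close>

lemma reduced_word_exists:
  assumes "u \<in> words_on X" "X \<subseteq> carrier G"
    and f: "\<And>p l q. p @ l # letter_inv l # q \<in> words_on X \<Longrightarrow> f (p @ l # letter_inv l # q) = f (p @ q)"
  shows "\<exists>v \<in> words_on X. reduced v \<and> word_value G v = word_value G u \<and> f v = f u"
  using assms(1)
proof (induction u rule: length_induct)
  case (1 u)
  show ?case
  proof (cases "reduced u")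
    case True
    with "1.prems" show ?thesis by blast
  next
    case False
    then obtain p l q where u: "u = p @ l # letter_inv l # q"
      by (rule not_reduced_imp_cancel)
    from "1.prems" u have "p @ q \<in> words_on X" by simp
    moreover have "length (p @ q) < length u" by (simp add: u)
    ultimately obtain v where "v \<in> words_on X" "reduced v"
      "word_value G v = word_value G (p @ q)" "f v = f (p @ q)"
      using "1.IH" by blast
    moreover have "word_value G u = word_value G (p @ q)"
      unfolding u using "1.prems" assms(2) u by (intro word_value_cancel) (blast intro: words_on_mono)
    moreover have "f u = f (p @ q)"
      using f "1.prems" u by blast
    ultimately show ?thesis by auto
  qed
qed

lemma generate_imp_word:
  assumes "X \<subseteq> carrier G" "g \<in> generate G X"
  shows "\<exists>u \<in> words_on X. reduced u \<and> word_value G u = g"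
proof -
  from assms(2) have "\<exists>u \<in> words_on X. word_value G u = g"
  proof induction
    case one
    show ?case by (rule bexI[of _ "[]"]) auto
  next
    case (incl h)
    then show ?case using assms(1)
      by (intro bexI[of _ "[(h, True)]"]) (auto simp: word_value_Cons letter_value_def)
  next
    case (inv h)
    then show ?case using assms(1)
      by (intro bexI[of _ "[(h, False)]"]) (auto simp: word_value_Cons letter_value_def)
  next
    case (eng g h)
    then obtain u v where "u \<in> words_on X" "v \<in> words_on X" "word_value G u = g" "word_value G v = h"
      by blast
    with assms(1) show ?case
      by (intro bexI[of _ "u @ v"]) (auto simp: word_value_append words_on_mono)
  qed
  then obtain u where u: "u \<in> words_on X" "word_value G u = g" by blast
  from reduced_word_exists[OF u(1) assms(1), of "\<lambda>_. ()"] u(2) show ?thesis by auto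
qed

lemma word_value_in_generate:
  "u \<in> words_on X \<Longrightarrow> word_value G u \<in> generate G X"
  by (induction u)
    (auto simp: word_value_Cons letter_value_def intro: generate.intros)

end

section \<open>Free groups and the reversal\<close>

locale free_group = group G for G (structure) +
  fixes X :: "'a set"
  assumes basis: "free_basis G X"
begin

lemma X_closed: "X \<subseteq> carrier G"
  using basis by (simp add: free_basis_def)

lemma words_on_carrier [simp]: "u \<in> words_on X \<Longrightarrow> u \<in> words_on (carrier G)"
  using X_closed words_on_mono by blast

definition rword :: "'a \<Rightarrow> 'a word" where
  "rword = inv_into {u \<in> words_on X. reduced u} (word_value G)"

lemma
  assumes "g \<in> carrier G"
  shows rword_words_on [simp]: "rword g \<in> words_on X"
    and reduced_rword [simp]: "reduced (rword g)"
    and word_value_rword [simp]: "word_value G (rword g) = g"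
proof -
  have *: "word_value G ` {u \<in> words_on X. reduced u} = carrier G"
    using basis by (simp add: free_basis_def bij_betw_def)
  with assms have g: "g \<in> word_value G ` {u \<in> words_on X. reduced u}" by simp
  show "rword g \<in> words_on X" "reduced (rword g)"
    using inv_into_into[OF g] by (auto simp: rword_def)
  show "word_value G (rword g) = g"
    using f_inv_into_f[OF g] by (simp add: rword_def)
qed

lemma rword_word_value [simp]:
  "u \<in> words_on X \<Longrightarrow> reduced u \<Longrightarrow> rword (word_value G u) = u"
  using basis by (auto simp: rword_def free_basis_def bij_betw_def)

lemma rword_one [simp]: "rword \<one> = []"
  using rword_word_value[of "[]"] by simp

lemma rword_inv: "g \<in> carrier G \<Longrightarrow> rword (inv g) = word_inv (rword g)"
  using rword_word_value[of "word_inv (rword g)"] by (simp add: word_value_word_inv)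

lemma rword_basis: "z \<in> X \<Longrightarrow> rword z = [(z, True)]"
  using rword_word_value[of "[(z, True)]"] X_closed
  by (auto simp: letter_value_def word_value_Cons simp del: rword_word_value)

lemma generate_basis: "generate G X = carrier G"
proof
  show "carrier G \<subseteq> generate G X"
  proof
    fix g assume "g \<in> carrier G"
    then show "g \<in> generate G X"
      using word_value_in_generate[of "rword g" X] by simp
  qed
qed (use X_closed in \<open>auto intro: generate_in_carrier\<close>)

text \<open>Cancellations alone lead to the normal form, so a quantity that they preserve can be
  computed on any word for the element. This serves for products, where the concatenation of reduced
  words need not be reduced.\<close>

lemma cancellation_invariant_rword:
  assumes "u \<in> words_on X"
    and "\<And>p l q. p @ l # letter_inv l # q \<in> words_on X \<Longrightarrow> f (p @ l # letter_inv l # q) = f (p @ q)"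
  shows "f (rword (word_value G u)) = f u"
proof -
  obtain v where v: "v \<in> words_on X" "reduced v" "word_value G v = word_value G u" "f v = f u"
    using reduced_word_exists[OF assms(1) X_closed, of f] assms(2) by blast
  with rword_word_value[OF v(1,2)] show ?thesis by simp
qed

definition reversal :: "'a \<Rightarrow> 'a" where
  "reversal g = word_value G (rev (rword g))"

lemma reversal_closed [simp]: "g \<in> carrier G \<Longrightarrow> reversal g \<in> carrier G"
  by (simp add: reversal_def)

lemma reversal_word_value:
  assumes "u \<in> words_on X"
  shows "reversal (word_value G u) = word_value G (rev u)"
  unfolding reversal_def
proof (rule cancellation_invariant_rword[OF assms, of "\<lambda>u. word_value G (rev u)"])
  fix p l q assume *: "p @ l # letter_inv l # q \<in> words_on X"
  \<comment> \<open>Reversal turns the pair \<open>l\<close>, \<open>letter_inv l\<close> into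
    another cancelling pair, now with first letter \<open>letter_inv l\<close>.\<close>
  then have "rev q @ letter_inv l # letter_inv (letter_inv l) # rev p \<in> words_on X"
    by simp
  from word_value_cancel[OF words_on_carrier[OF this]]
  show "word_value G (rev (p @ l # letter_inv l # q)) = word_value G (rev (p @ q))"
    by simp
qed

lemma reversal_mult:
  assumes "g \<in> carrier G" "h \<in> carrier G"
  shows "reversal (g \<otimes> h) = reversal h \<otimes> reversal g"
proof -
  have "g \<otimes> h = word_value G (rword g @ rword h)"
    using assms by (simp add: word_value_append)
  then have "reversal (g \<otimes> h) = word_value G (rev (rword g @ rword h))"
    using assms reversal_word_value[of "rword g @ rword h"] by simp
  with assms show ?thesis
    by (simp add: word_value_append reversal_def)
qed

lemma reversal_one [simp]: "reversal \<one> = \<one>"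
  by (simp add: reversal_def)

lemma reversal_basis: "z \<in> X \<Longrightarrow> reversal z = z"
  using word_value_rword[of z] X_closed
  by (auto simp: reversal_def rword_basis simp del: word_value_rword)

lemma reversal_inv:
  assumes "g \<in> carrier G"
  shows "reversal (inv g) = inv (reversal g)"
  using reversal_mult[of g "inv g"] assms by (metis inv_closed inv_equality r_inv reversal_closed reversal_one)

lemma reversal_reversal [simp]: "g \<in> carrier G \<Longrightarrow> reversal (reversal g) = g"
  using reversal_word_value[of "rev (rword g)"] by (simp add: reversal_def)

text \<open>The reversal of a reduced word is reduced, so by uniqueness of reduced words the
  elements agree only if the words do.\<close>

lemma palindrome_iff_reversal:
  assumes "g \<in> carrier G"
  shows "palindrome G X g \<longleftrightarrow> reversal g = g"
proof
  assume "palindrome G X g"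
  then show "reversal g = g"
    by (auto simp: palindrome_def reversal_def)
next
  assume "reversal g = g"
  then have "rword (word_value G (rev (rword g))) = rword g"
    by (simp add: reversal_def)
  with assms have "rev (rword g) = rword g" by simp
  with assms show "palindrome G X g"
    unfolding palindrome_def by (intro bexI[of _ "rword g"]) auto
qed

text \<open>This is the homomorphism to the group of order two that is nontrivial on exactly the
  basis elements in \<open>S\<close>.\<close>

definition parity :: "'a set \<Rightarrow> 'a \<Rightarrow> bool" where
  "parity S g \<longleftrightarrow> odd (length (filter (\<lambda>l. fst l \<in> S) (rword g)))"

lemma parity_word_value:
  assumes "u \<in> words_on X"
  shows "parity S (word_value G u) \<longleftrightarrow> odd (length (filter (\<lambda>l. fst l \<in> S) u))"
  unfolding parity_def
  by (rule cancellation_invariant_rword[OF assms, of "\<lambda>u. odd (length (filter (\<lambda>l. fst l \<in> S) u))"]) auto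

lemma parity_mult:
  assumes "g \<in> carrier G" "h \<in> carrier G"
  shows "parity S (g \<otimes> h) \<longleftrightarrow> parity S g \<noteq> parity S h"
proof -
  have "g \<otimes> h = word_value G (rword g @ rword h)"
    using assms by (simp add: word_value_append)
  with assms show ?thesis
    by (simp add: parity_word_value) (auto simp: parity_def)
qed

lemma parity_one [simp]: "\<not> parity S \<one>"
  by (simp add: parity_def)

lemma parity_inv: "g \<in> carrier G \<Longrightarrow> parity S (inv g) = parity S g"
  using parity_mult[of g "inv g" S] by simp

lemma parity_basis: "z \<in> X \<Longrightarrow> parity S z \<longleftrightarrow> z \<in> S"
  by (simp add: parity_def rword_basis)

lemma parity_eq_generate:
  assumes "Y \<subseteq> carrier G" "\<And>y. y \<in> Y \<Longrightarrow> parity S y = parity T y" "g \<in> generate G Y"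
  shows "parity S g = parity T g"
  using assms(3)
proof induction
  case (inv h)
  with assms(1,2) show ?case by (auto simp: parity_inv)
next
  case (eng g h)
  with assms(1) generate_in_carrier[OF assms(1)] show ?case by (simp add: parity_mult)
qed (use assms in auto)

text \<open>A homomorphism to the group of order two is determined by its values on \<open>{x, y}\<close>, and
  three basis elements would give eight of them.\<close>

lemma basis_card_le_2:
  assumes "x \<in> carrier G" "y \<in> carrier G" "generate G {x, y} = carrier G"
    and "S \<subseteq> X" "finite S"
  shows "card S \<le> 2"
proof -
  \<comment> \<open>\<open>parity T\<close> is determined by its values on the generators
    \<open>x\<close> and \<open>y\<close>, and evaluating it on \<open>S\<close> recovers
    \<open>T\<close>. Hence \<open>S\<close> has at most four subsets.\<close>
  have "inj_on (\<lambda>T. (parity T x, parity T y)) (Pow S)"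
  proof (rule inj_onI)
    fix T U assume TU: "T \<in> Pow S" "U \<in> Pow S" "(parity T x, parity T y) = (parity U x, parity U y)"
    have "parity T g = parity U g" if "g \<in> carrier G" for g
      by (rule parity_eq_generate[of "{x, y}"]) (use assms TU that in auto)
    then have "z \<in> T \<longleftrightarrow> z \<in> U" if "z \<in> S" for z
      using that parity_basis[of z] X_closed assms(4) by blast
    with TU(1,2) show "T = U" by blast
  qed
  then have "card (Pow S) \<le> card (UNIV :: (bool \<times> bool) set)"
    by (intro card_inj_on_le[of _ _ UNIV]) auto
  then have "2 ^ card S \<le> (2::nat) ^ 2"
    using assms(5) by (simp add: card_Pow card_cartesian_product flip: UNIV_Times_UNIV)
  then show ?thesis
    by (rule power_le_imp_le_exp[rotated]) simp
qed

section \<open>Length and Nielsen reduced sets\<close>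

definition len :: "'a \<Rightarrow> nat" where
  "len g = length (rword g)"

text \<open>This is the Gromov product based at the identity in the Cayley tree of \<open>X\<close>.
  In particular, \<open>gromov (inv g) h\<close> is the number of letters that each factor loses in
  \<open>g \<otimes> h\<close>.\<close>

definition gromov :: "'a \<Rightarrow> 'a \<Rightarrow> nat" where
  "gromov g h = length (longest_common_prefix (rword g) (rword h))"

lemma len_one [simp]: "len \<one> = 0"
  by (simp add: len_def)

lemma len_eq_0_iff [simp]: "g \<in> carrier G \<Longrightarrow> len g = 0 \<longleftrightarrow> g = \<one>"
  using word_value_rword[of g] by (auto simp: len_def simp del: word_value_rword)

lemma len_inv [simp]: "g \<in> carrier G \<Longrightarrow> len (inv g) = len g"
  by (simp add: len_def rword_inv)

lemma len_basis: "z \<in> X \<Longrightarrow> len z = 1"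
  by (simp add: len_def rword_basis)

text \<open>The common prefix cancels in \<open>inv g \<otimes> h\<close>. Nothing more cancels,
  because the remainders begin with different letters or one of them is empty.\<close>

lemma len_inv_mult:
  assumes "g \<in> carrier G" "h \<in> carrier G"
  shows "len (inv g \<otimes> h) + 2 * gromov g h = len g + len h"
proof -
  obtain p u v where p: "p = longest_common_prefix (rword g) (rword h)"
    and g: "rword g = p @ u" and h: "rword h = p @ v"
    and uv: "u = [] \<or> v = [] \<or> hd u \<noteq> hd v"
    using longest_common_prefix_maximal[of "rword g" "rword h"] by blast
  have red: "reduced u" "reduced v" and on: "p \<in> words_on X" "u \<in> words_on X" "v \<in> words_on X"
    using assms reduced_rword[of g] reduced_rword[of h] rword_words_on[of g] rword_words_on[of h]
    by (simp_all add: g h reduced_append_iff del: reduced_rword rword_words_on)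
  have "g = word_value G p \<otimes> word_value G u" "h = word_value G p \<otimes> word_value G v"
    using assms on word_value_rword[of g] word_value_rword[of h]
    by (simp_all add: g h word_value_append del: word_value_rword)
  then have "inv g \<otimes> h = inv (word_value G u) \<otimes> (inv (word_value G p) \<otimes> (word_value G p \<otimes> word_value G v))"
    using on by (simp add: inv_mult_group m_assoc)
  also have "\<dots> = word_value G (word_inv u @ v)"
    using on by (simp add: word_value_append word_value_word_inv m_assoc[symmetric])
  finally have "rword (inv g \<otimes> h) = word_inv u @ v"
    using on red uv rword_word_value[of "word_inv u @ v"]
    by (cases "u = []") (auto simp: reduced_append_iff last_word_inv word_inv_def[of "[]"])
  then show ?thesis
    unfolding len_def gromov_def p[symmetric] by (simp add: g h)
qed

lemma gromov_commute: "gromov g h = gromov h g"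
  by (simp add: gromov_def longest_common_prefix_commute)

lemma gromov_le: "gromov g h \<le> len g" "gromov g h \<le> len h"
  unfolding gromov_def len_def
  by (simp_all add: longest_common_prefix_prefix1 longest_common_prefix_prefix2 prefix_length_le)

text \<open>The Cayley tree is \<open>0\<close>-hyperbolic.\<close>

lemma gromov_min: "min (gromov g h) (gromov h k) \<le> gromov g k"
proof -
  define n where "n = min (gromov g h) (gromov h k)"
  have "n \<le> gromov g h" "n \<le> gromov h k" by (simp_all add: n_def)
  \<comment> \<open>Equality of the initial segments of length \<open>n\<close> is transitive
    through \<open>h\<close>.\<close>
  then have "n \<le> gromov g k"
    by (simp add: gromov_def le_length_longest_common_prefix_iff)
  then show ?thesis by (simp add: n_def)
qed

text \<open>If half of \<open>g\<close> cancelled in \<open>g \<otimes> g\<close>, the words of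
  \<open>g\<close> and \<open>inv g\<close> would agree on their first halves. Then the middle
  letter would be its own inverse, or the two middle letters would be inverse to each other, against
  reducedness.\<close>

lemma gromov_inv_self:
  assumes "g \<in> carrier G" "g \<noteq> \<one>"
  shows "2 * gromov (inv g) g < len g"
proof (rule ccontr)
  define u where "u = rword g"
  \<comment> \<open>Counted from zero, \<open>i\<close> is the middle position or the left one of
    two, and \<open>Suc i\<close> is half the length rounded up.\<close>
  define i where "i = (length u - 1) div 2"
  have "u \<noteq> []"
    using assms len_eq_0_iff[of g] by (auto simp: u_def len_def)
  then have "0 < length u" by simp
  then have i: "i < length u" "length u - 1 - i < length u"
    unfolding i_def by linarith+
  assume "\<not> 2 * gromov (inv g) g < len g"
  then have "length u \<le> 2 * gromov (inv g) g" by (simp add: len_def u_def)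
  with \<open>0 < length u\<close> have "Suc i \<le> gromov (inv g) g"
    unfolding i_def by linarith
  then have "take (Suc i) (word_inv u) = take (Suc i) u"
    using assms by (simp add: gromov_def le_length_longest_common_prefix_iff rword_inv u_def)
  then have "word_inv u ! i = u ! i"
    by (metis lessI nth_take)
  with i have eq: "letter_inv (u ! (length u - 1 - i)) = u ! i"
    by (simp add: word_inv_def rev_nth)
  have "length u - 1 - i = i \<or> length u - 1 - i = Suc i"
    unfolding i_def by linarith
  then show False
  proof
    assume "length u - 1 - i = i"
    with eq show False by simp
  next
    assume *: "length u - 1 - i = Suc i"
    with i have "u = take i u @ u ! i # u ! Suc i # drop (Suc (Suc i)) u"
      by (simp add: Cons_nth_drop_Suc)
    moreover have "reduced u" using assms by (simp add: u_def)
    ultimately have "u ! Suc i \<noteq> letter_inv (u ! i)"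
      by (metis reduced_append_iff reduced_Cons_Cons)
    moreover from eq have "u ! Suc i = letter_inv (u ! i)"
      unfolding * by (metis letter_inv_letter_inv)
    ultimately show False by contradiction
  qed
qed

text \<open>With \<open>len l = 1\<close>, the equation \<open>gromov l g = 1\<close> says that the
  word of \<open>g\<close> begins with \<open>l\<close>. Such an \<open>l\<close> serves later as a
  conjugator.\<close>

lemma first_letter_exists:
  assumes "g \<in> carrier G" "g \<noteq> \<one>"
  obtains l where "l \<in> carrier G" "len l = 1" "gromov l g = 1"
proof -
  obtain k u where u: "rword g = k # u"
    using assms len_eq_0_iff[of g] by (cases "rword g") (auto simp: len_def)
  have k: "[k] \<in> words_on X"
    using rword_words_on[OF assms(1)] by (simp add: u)
  define l where "l = word_value G [k]"
  have "rword l = [k]" using k unfolding l_def by (intro rword_word_value) auto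
  then have "len l = 1" "gromov l g = 1" by (simp_all add: len_def gromov_def u)
  moreover have "l \<in> carrier G"
    using k unfolding l_def by (intro word_value_closed words_on_carrier)
  ultimately show thesis using that by blast
qed

text \<open>A form of Nielsen's condition: no letter of a reduced word is cancelled completely by its
  two neighbours.\<close>

definition nielsen_reduced :: "'a set \<Rightarrow> bool" where
  "nielsen_reduced S \<longleftrightarrow>
     (\<forall>s t r. [s, t, r] \<in> words_on S \<and> reduced [s, t, r] \<longrightarrow>
       gromov (inv (letter_value G s)) (letter_value G t)
         + gromov (inv (letter_value G t)) (letter_value G r) < len (letter_value G t))"

lemma nielsen_reducedD:
  assumes "nielsen_reduced S" "{fst s, fst t, fst r} \<subseteq> S" "reduced [s, t, r]"
  shows "gromov (inv (letter_value G s)) (letter_value G t)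
    + gromov (inv (letter_value G t)) (letter_value G r) < len (letter_value G t)"
proof -
  have "[s, t, r] \<in> words_on S" using assms(2) by simp
  with assms(1,3) show ?thesis unfolding nielsen_reduced_def by blast
qed

text \<open>Part of each factor stays between the cancellations on its two sides, so
  \<open>r\<close> cancels against the whole product exactly as against the last factor. The summand
  \<open>c (last u) r\<close> in the length bound reserves the letters that the next factor will
  cancel.\<close>

lemma nielsen_reduced_gromov_last:
  assumes S: "S \<subseteq> carrier G" "nielsen_reduced S"
    and "u @ [r] \<in> words_on S" "reduced (u @ [r])" "u \<noteq> []"
  defines "c s t \<equiv> gromov (inv (letter_value G s)) (letter_value G t)"
  shows "gromov (inv (word_value G u)) (letter_value G r) = c (last u) r \<and>
    length u + c (last u) r \<le> len (word_value G u)"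
  using assms(3-5)
proof (induction u arbitrary: r rule: rev_induct)
  case (snoc t h)
  have tr: "fst t \<in> S" "fst r \<in> S" "reduced [t, r]" "h \<in> words_on S"
    using snoc.prems by (auto simp: reduced_append_iff)
  with S have closed [simp]: "letter_value G t \<in> carrier G" "letter_value G r \<in> carrier G"
    by auto
  show ?case
  proof (cases "h = []")
    case True
    \<comment> \<open>The condition asks for a left neighbour; \<open>t\<close> itself can serve,
      since no letter is its own inverse.\<close>
    have "c t t + c t r < len (letter_value G t)"
      using nielsen_reducedD[OF S(2), of t t r] tr unfolding c_def by simp
    with True show ?thesis using tr S by (auto simp: c_def)
  next
    case False
    define v T where "v = word_value G h" and "T = letter_value G t"
    have v [simp]: "v \<in> carrier G" and T [simp]: "T \<in> carrier G"
      using tr S words_on_mono[of h S] by (auto simp: v_def T_def)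
    have ht: "word_value G (h @ [t]) = v \<otimes> T"
      using tr S words_on_mono[of h S] by (subst word_value_append) (auto simp: v_def T_def)
    have red: "h @ [t] \<in> words_on S" "reduced (h @ [t])" "reduced [last h, t]"
      using snoc.prems False by (auto simp: reduced_append_iff)
    have IH: "gromov (inv v) T = c (last h) t" "length h + c (last h) t \<le> len v"
      using snoc.IH[OF red(1,2) False] by (simp_all add: v_def T_def)
    have N: "c (last h) t + c t r < len T"
      using nielsen_reducedD[OF S(2), of "last h" t r] tr red imageI[OF last_in_set[OF False], of fst]
      unfolding c_def T_def by (auto simp: words_on_def)
    have "len (v \<otimes> T) + 2 * gromov (inv v) T = len v + len T"
      using len_inv_mult[of "inv v" T] by simp
    with IH have len: "len (v \<otimes> T) + 2 * c (last h) t = len v + len T" by simp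
    have "len v + 2 * gromov (inv (v \<otimes> T)) (inv T) = len (v \<otimes> T) + len T"
      using len_inv_mult[of "inv (v \<otimes> T)" "inv T"] by (simp add: m_assoc)
    \<comment> \<open>More letters of \<open>T\<close> survive at the end of the product than
      \<open>r\<close> cancels from \<open>T\<close>. Hence \<open>r\<close> cannot tell the product
      from \<open>T\<close>; the two instances of \<open>gromov_min\<close> give the two
      inequalities.\<close>
    with len N have "c t r < gromov (inv (v \<otimes> T)) (inv T)" by linarith
    with gromov_min[of "inv (v \<otimes> T)" "inv T" "letter_value G r"]
      gromov_min[of "inv T" "inv (v \<otimes> T)" "letter_value G r"]
    have "gromov (inv (v \<otimes> T)) (letter_value G r) = c t r"
      by (simp add: c_def gromov_commute[of "inv T"] flip: T_def)
    with len N IH ht show ?thesis by simp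
  qed
qed simp

lemma nielsen_reduced_length_le:
  assumes "S \<subseteq> carrier G" "nielsen_reduced S" "u \<in> words_on S" "reduced u"
  shows "length u \<le> len (word_value G u)"
proof (cases "u = []")
  case False
  \<comment> \<open>The previous lemma needs a following letter; repeating the last one keeps the
    word reduced.\<close>
  with assms(3,4) have "u @ [last u] \<in> words_on S" "reduced (u @ [last u])"
    by (auto simp: reduced_append_iff words_on_def)
  with nielsen_reduced_gromov_last[OF assms(1,2) this False] show ?thesis by linarith
qed simp

text \<open>A basis element has length one, so a reduced word in \<open>S\<close> that represents it
  has exactly one letter.\<close>

lemma nielsen_reduced_generates_basis:
  assumes "S \<subseteq> carrier G" "nielsen_reduced S" "generate G S = carrier G" "z \<in> X"
  shows "z \<in> S \<or> inv z \<in> S"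
proof -
  have z: "z \<in> carrier G" using assms(4) X_closed by blast
  then obtain u where u: "u \<in> words_on S" "reduced u" "word_value G u = z"
    using generate_imp_word[OF assms(1), of z] assms(3) by auto
  then have "length u \<le> 1"
    using nielsen_reduced_length_le[OF assms(1,2) u(1,2)] len_basis[OF assms(4)] by simp
  moreover have "u \<noteq> []"
    using u(3) len_basis[OF assms(4)] by auto
  ultimately obtain l where "u = [l]" by (cases u) auto
  with u assms(1) show ?thesis
    by (auto simp: letter_value_def split: if_splits)
qed

end

section \<open>Generating pairs\<close>

context group
begin

lemma inv_mult_cancel_left [simp]:
  "g \<in> carrier G \<Longrightarrow> h \<in> carrier G \<Longrightarrow> inv g \<otimes> (g \<otimes> h) = h"
  and mult_inv_cancel_left [simp]:
  "g \<in> carrier G \<Longrightarrow> h \<in> carrier G \<Longrightarrow> g \<otimes> (inv g \<otimes> h) = h"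
  by (simp_all flip: m_assoc)

definition generating_pair :: "'a \<Rightarrow> 'a \<Rightarrow> bool" where
  "generating_pair a b \<longleftrightarrow> a \<in> carrier G \<and> b \<in> carrier G \<and> generate G {a, b} = carrier G"

lemma generate_eq_carrierI:
  assumes "generate G S = carrier G" "S \<subseteq> generate G T" "T \<subseteq> carrier G"
  shows "generate G T = carrier G"
  using generate_subgroup_incl[OF assms(2) generate_is_subgroup[OF assms(3)]]
    generate_incl[OF assms(3)] assms(1) by blast

lemma generating_pair_swap: "generating_pair a b \<Longrightarrow> generating_pair b a"
  by (simp add: generating_pair_def insert_commute)

lemma generating_pair_inv:
  assumes "generating_pair a b"
  shows "generating_pair (inv a) b"
proof -
  have ab: "a \<in> carrier G" "b \<in> carrier G" "generate G {a, b} = carrier G"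
    using assms by (auto simp: generating_pair_def)
  have "inv (inv a) \<in> generate G {inv a, b}" by (rule generate.inv) simp
  then have "{a, b} \<subseteq> generate G {inv a, b}" using ab by (auto intro: generate.incl)
  from generate_eq_carrierI[OF ab(3) this] ab show ?thesis
    by (auto simp: generating_pair_def)
qed

lemma generating_pair_mult:
  assumes "generating_pair a b"
  shows "generating_pair (a \<otimes> b) b"
proof -
  have ab: "a \<in> carrier G" "b \<in> carrier G" "generate G {a, b} = carrier G"
    using assms by (auto simp: generating_pair_def)
  have "(a \<otimes> b) \<otimes> inv b \<in> generate G {a \<otimes> b, b}"
    by (intro generate.eng[OF generate.incl generate.inv]) auto
  then have "{a, b} \<subseteq> generate G {a \<otimes> b, b}"
    using ab by (auto intro: generate.incl simp: m_assoc)
  from generate_eq_carrierI[OF ab(3) this] ab show ?thesis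
    by (auto simp: generating_pair_def)
qed

lemma generating_pair_conj:
  assumes "generating_pair a b" and g [simp]: "g \<in> carrier G"
  shows "generating_pair (inv g \<otimes> a \<otimes> g) (inv g \<otimes> b \<otimes> g)"
proof -
  have ab [simp]: "a \<in> carrier G" "b \<in> carrier G" and gen: "generate G {a, b} = carrier G"
    using assms by (auto simp: generating_pair_def)
  define H where "H = generate G {inv g \<otimes> a \<otimes> g, inv g \<otimes> b \<otimes> g}"
  have *: "inv g \<otimes> h \<otimes> g \<in> H" if "h \<in> generate G {a, b}" for h
    using that
  proof induction
    case one
    show ?case by (simp add: H_def generate.one)
  next
    case (incl h)
    then show ?case by (auto simp: H_def intro: generate.incl)
  next
    case (inv h)
    then have "inv (inv g \<otimes> h \<otimes> g) \<in> H"
      unfolding H_def by (intro generate.inv) auto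
    with inv show ?case by (auto simp: inv_mult_group m_assoc)
  next
    case (eng h k)
    then have [simp]: "h \<in> carrier G" "k \<in> carrier G" by (simp_all add: gen)
    from eng.IH have "(inv g \<otimes> h \<otimes> g) \<otimes> (inv g \<otimes> k \<otimes> g) \<in> H"
      unfolding H_def by (rule generate.eng)
    then show ?case by (simp add: m_assoc)
  qed
  \<comment> \<open>Every \<open>k\<close> is the conjugate of
    \<open>g \<otimes> k \<otimes> inv g\<close>, which \<open>a\<close> and \<open>b\<close>
    generate.\<close>
  have "k \<in> H" if "k \<in> carrier G" for k
  proof -
    have "inv g \<otimes> (g \<otimes> k \<otimes> inv g) \<otimes> g \<in> H"
      using that by (intro *) (simp add: gen)
    with that show ?thesis by (simp add: m_assoc)
  qed
  moreover have "H \<subseteq> carrier G"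
    unfolding H_def by (rule generate_incl) auto
  ultimately show ?thesis
    unfolding generating_pair_def by (auto simp: H_def)
qed

end

section \<open>Reversible pairs under Nielsen moves and conjugation\<close>

context free_group
begin

text \<open>For palindromic \<open>u\<close>, this says that \<open>u \<otimes> a\<close> and \<open>u \<otimes> b\<close> are palindromes.\<close>

definition reversible_pair :: "'a \<Rightarrow> 'a \<Rightarrow> bool" where
  "reversible_pair a b \<longleftrightarrow> (\<exists>u \<in> carrier G. reversal u = u \<and>
     reversal a \<otimes> u = u \<otimes> a \<and> reversal b \<otimes> u = u \<otimes> b)"

lemma reversible_pair_swap: "reversible_pair a b \<Longrightarrow> reversible_pair b a"
  by (auto simp: reversible_pair_def)

lemma reversible_pair_inv:
  assumes "reversible_pair a b" "a \<in> carrier G"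
  shows "reversible_pair (inv a) b"
proof -
  obtain u where u [simp]: "u \<in> carrier G" and
    eqs: "reversal u = u" "reversal a \<otimes> u = u \<otimes> a" "reversal b \<otimes> u = u \<otimes> b"
    using assms(1) by (auto simp: reversible_pair_def)
  note [simp] = assms(2)
  have "u \<otimes> inv a = inv (reversal a) \<otimes> (reversal a \<otimes> u) \<otimes> inv a" by simp
  also have "\<dots> = inv (reversal a) \<otimes> u" unfolding eqs(2) by (simp add: m_assoc)
  finally have "u \<otimes> inv a = inv (reversal a) \<otimes> u" .
  with eqs assms(2) show ?thesis
    by (auto simp: reversible_pair_def reversal_inv intro!: bexI[of _ u])
qed

lemma reversible_pair_mult:
  assumes "reversible_pair a b" and [simp]: "a \<in> carrier G" "b \<in> carrier G"
  shows "reversible_pair (a \<otimes> b) b"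
proof -
  obtain u where u [simp]: "u \<in> carrier G" and
    eqs: "reversal u = u" "reversal a \<otimes> u = u \<otimes> a" "reversal b \<otimes> u = u \<otimes> b"
    using assms(1) by (auto simp: reversible_pair_def)
  have "reversal (u \<otimes> b) = u \<otimes> b" by (simp add: reversal_mult eqs)
  moreover have "reversal (a \<otimes> b) \<otimes> (u \<otimes> b) = (u \<otimes> b) \<otimes> (a \<otimes> b)"
  proof -
    have "reversal (a \<otimes> b) \<otimes> (u \<otimes> b) = reversal b \<otimes> (reversal a \<otimes> u) \<otimes> b"
      by (simp add: reversal_mult m_assoc)
    also have "\<dots> = (reversal b \<otimes> u) \<otimes> (a \<otimes> b)"
      by (simp add: eqs(2) m_assoc)
    finally show ?thesis by (simp add: eqs(3))
  qed
  moreover have "reversal b \<otimes> (u \<otimes> b) = (u \<otimes> b) \<otimes> b"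
    by (simp add: eqs(3) flip: m_assoc)
  ultimately show ?thesis
    unfolding reversible_pair_def by (intro bexI[of _ "u \<otimes> b"]) auto
qed

lemma reversible_pair_conj:
  assumes "reversible_pair a b" and [simp]: "a \<in> carrier G" "b \<in> carrier G" "g \<in> carrier G"
  shows "reversible_pair (inv g \<otimes> a \<otimes> g) (inv g \<otimes> b \<otimes> g)"
proof -
  obtain u where u [simp]: "u \<in> carrier G" and
    eqs: "reversal u = u" "reversal a \<otimes> u = u \<otimes> a" "reversal b \<otimes> u = u \<otimes> b"
    using assms(1) by (auto simp: reversible_pair_def)
  \<comment> \<open>\<open>reversal\<close> exchanges the outer factors of \<open>v\<close> and
    fixes \<open>u\<close>. In \<open>v \<otimes> (inv g \<otimes> c \<otimes> g)\<close> the inner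
    \<open>g\<close> and \<open>inv g\<close> cancel, which leaves \<open>u \<otimes> c\<close> in
    the middle.\<close>
  define v where "v = reversal g \<otimes> u \<otimes> g"
  have "reversal v = v"
    by (simp add: v_def reversal_mult eqs m_assoc)
  moreover have "reversal (inv g \<otimes> c \<otimes> g) \<otimes> v = v \<otimes> (inv g \<otimes> c \<otimes> g)"
    if c [simp]: "c \<in> carrier G" and eq: "reversal c \<otimes> u = u \<otimes> c" for c
  proof -
    have "reversal (inv g \<otimes> c \<otimes> g) \<otimes> v = reversal g \<otimes> (reversal c \<otimes> u) \<otimes> g"
      by (simp add: v_def reversal_mult reversal_inv m_assoc)
    also have "\<dots> = v \<otimes> (inv g \<otimes> c \<otimes> g)"
      unfolding eq by (simp add: v_def m_assoc)
    finally show ?thesis .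
  qed
  ultimately show ?thesis
    using eqs unfolding reversible_pair_def by (intro bexI[of _ v]) (auto simp: v_def)
qed

text \<open>Multiplying \<open>a \<otimes> b\<close> by \<open>inv b\<close> undoes the move. The
  equivalence brings reversibility back from a shortened pair.\<close>

lemma reversible_pair_mult_iff:
  assumes [simp]: "a \<in> carrier G" "b \<in> carrier G"
  shows "reversible_pair (a \<otimes> b) b \<longleftrightarrow> reversible_pair a b"
proof
  assume "reversible_pair (a \<otimes> b) b"
  then have "reversible_pair (a \<otimes> b) (inv b)"
    by (intro reversible_pair_swap[OF reversible_pair_inv[OF reversible_pair_swap]]) auto
  then have "reversible_pair (a \<otimes> b \<otimes> inv b) (inv b)"
    by (rule reversible_pair_mult) auto
  then have "reversible_pair a (inv b)" by (simp add: m_assoc)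
  then have "reversible_pair (inv (inv b)) a"
    by (intro reversible_pair_inv[OF reversible_pair_swap]) auto
  then show "reversible_pair a b" using reversible_pair_swap[of b a] by simp
qed (simp add: reversible_pair_mult)

lemma reversible_pair_conj_iff:
  assumes [simp]: "a \<in> carrier G" "b \<in> carrier G" "g \<in> carrier G"
  shows "reversible_pair (inv g \<otimes> a \<otimes> g) (inv g \<otimes> b \<otimes> g) \<longleftrightarrow> reversible_pair a b"
proof
  have conj: "inv (inv g) \<otimes> (inv g \<otimes> c \<otimes> g) \<otimes> inv g = c" if "c \<in> carrier G" for c
    using that by (simp add: m_assoc)
  assume "reversible_pair (inv g \<otimes> a \<otimes> g) (inv g \<otimes> b \<otimes> g)"
  from reversible_pair_conj[OF this, of "inv g"] show "reversible_pair a b"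
    by (simp only: conj assms m_closed inv_closed)
qed (simp add: reversible_pair_conj)

section \<open>Cancellation in minimal counterexamples\<close>

definition minimal_counterexample :: "'a \<Rightarrow> 'a \<Rightarrow> bool" where
  "minimal_counterexample a b \<longleftrightarrow> generating_pair a b \<and> \<not> reversible_pair a b \<and>
     (\<forall>a' b'. generating_pair a' b' \<and> len a' + len b' < len a + len b \<longrightarrow> reversible_pair a' b')"

lemma minimal_counterexample_closed:
  "minimal_counterexample a b \<Longrightarrow> a \<in> carrier G" "minimal_counterexample a b \<Longrightarrow> b \<in> carrier G"
  by (auto simp: minimal_counterexample_def generating_pair_def)

lemma minimal_counterexample_swap:
  "minimal_counterexample a b \<Longrightarrow> minimal_counterexample b a"
  using reversible_pair_swap[of b a] generating_pair_swap[of a b]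
  by (auto simp: minimal_counterexample_def add.commute)

lemma minimal_counterexample_inv:
  assumes "minimal_counterexample a b"
  shows "minimal_counterexample (inv a) b"
proof -
  note [simp] = minimal_counterexample_closed[OF assms]
  have "\<not> reversible_pair (inv a) b"
    using assms reversible_pair_inv[of "inv a" b] by (auto simp: minimal_counterexample_def)
  with assms show ?thesis
    by (auto simp: minimal_counterexample_def generating_pair_inv)
qed

text \<open>Exchange and inversion preserve total length, generation and reversibility, so facts
  about \<open>a\<close> and \<open>b\<close> apply to any two letters over different
  entries.\<close>

lemma minimal_counterexample_letters:
  assumes "minimal_counterexample a b" "fst s \<in> {a, b}" "fst t \<in> {a, b}" "fst s \<noteq> fst t"
  shows "minimal_counterexample (letter_value G s) (letter_value G t)"
proof -
  have inv: "minimal_counterexample (letter_value G l) c"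
    if "minimal_counterexample (fst l) c" for l c
    using that by (simp add: letter_value_def minimal_counterexample_inv)
  have "minimal_counterexample (fst s) (fst t)"
    using assms minimal_counterexample_swap[OF assms(1)] by auto
  then show ?thesis
    by (rule inv[THEN minimal_counterexample_swap, THEN inv, THEN minimal_counterexample_swap])
qed

text \<open>If more than half of \<open>b\<close> cancelled in \<open>a \<otimes> b\<close>, the
  product would be shorter than \<open>a\<close>, and putting it in place of \<open>a\<close> would
  give a shorter generating pair that is still not reversible.\<close>

lemma minimal_counterexample_gromov_le:
  assumes "minimal_counterexample a b"
  shows "2 * gromov (inv a) b \<le> len a" "2 * gromov (inv a) b \<le> len b"
proof -
  have *: "len a \<le> len (a \<otimes> b)" if M: "minimal_counterexample a b" for a b
  proof (rule ccontr)
    assume "\<not> len a \<le> len (a \<otimes> b)"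
    then have "reversible_pair (a \<otimes> b) b"
      using M generating_pair_mult[of a b] by (auto simp: minimal_counterexample_def)
    with M show False
      using reversible_pair_mult_iff[of a b] minimal_counterexample_closed[OF M]
      by (simp add: minimal_counterexample_def)
  qed
  note [simp] = minimal_counterexample_closed[OF assms]
  \<comment> \<open>In the inverse product \<open>inv b \<otimes> inv a\<close> the two entries
    exchange roles, which gives the other bound.\<close>
  have "minimal_counterexample (inv b) (inv a)"
    by (rule assms[THEN minimal_counterexample_inv, THEN minimal_counterexample_swap,
          THEN minimal_counterexample_inv])
  from *[OF this] have "len b \<le> len (inv b \<otimes> inv a)" by simp
  also have "inv b \<otimes> inv a = inv (a \<otimes> b)" by (simp add: inv_mult_group)
  finally have "len b \<le> len (a \<otimes> b)" by simp
  with *[OF assms] len_inv_mult[of "inv a" b]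
  show "2 * gromov (inv a) b \<le> len a" "2 * gromov (inv a) b \<le> len b" by simp_all
qed

text \<open>The equations say that \<open>b\<close> is half cancelled in \<open>a \<otimes> b\<close> and half cancelled in \<open>b \<otimes> a\<close>.
  Then \<open>a \<otimes> b\<close> is as long as \<open>a\<close>, and conjugating it by the first letter of \<open>a\<close> shortens it,
  while \<open>b\<close> does not get longer.\<close>

lemma minimal_counterexample_not_half:
  assumes M: "minimal_counterexample a b" and "a \<noteq> \<one>" "b \<noteq> \<one>"
    and half: "2 * gromov (inv a) b = len b" "2 * gromov (inv b) a = len b"
  shows False
proof -
  note [simp] = minimal_counterexample_closed[OF M]
  obtain l where [simp]: "l \<in> carrier G" and l: "len l = 1" "gromov l a = 1"
    using first_letter_exists[of a] \<open>a \<noteq> \<one>\<close> by auto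
  define k where "k = gromov (inv a) b"
  define e where "e = a \<otimes> b"
  have [simp]: "e \<in> carrier G" by (simp add: e_def)
  have k: "len b = 2 * k" "gromov (inv b) a = k" using half by (auto simp: k_def)
  have "k \<noteq> 0" using \<open>b \<noteq> \<one>\<close> k(1) len_eq_0_iff[of b] by auto
  have ka: "2 * k \<le> len a"
    using minimal_counterexample_gromov_le(1)[OF M] by (simp add: k_def)
  have len_e: "len e = len a"
    using len_inv_mult[of "inv a" b] half by (simp add: e_def)
  have le1: "gromov l g \<le> 1" for g
    using gromov_le(1)[of l g] l by simp
  \<comment> \<open>\<open>a\<close> and \<open>inv b\<close> share their first \<open>k\<close>
    letters, so \<open>b\<close> ends in the inverse of \<open>l\<close>. Conjugation by
    \<open>l\<close> cancels this letter and adds at most one in front.\<close>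
  have lb: "gromov l (inv b) = 1"
    using gromov_min[of l a "inv b"] le1[of "inv b"] l k(2) \<open>k \<noteq> 0\<close>
    by (simp add: gromov_commute[of a])
  have "len (b \<otimes> l) + 2 = len b + 1"
    using len_inv_mult[of "inv b" l] lb l by (simp add: gromov_commute[of "inv b"])
  with len_inv_mult[of l "b \<otimes> l"] l have conj_b: "len (inv l \<otimes> b \<otimes> l) \<le> len b"
    by (simp add: m_assoc)
  \<comment> \<open>\<open>a\<close> and \<open>e\<close> share at least \<open>k\<close> initial
    letters, so \<open>e\<close> begins with \<open>l\<close> too.\<close>
  have "inv a \<otimes> e = b" by (simp add: e_def flip: m_assoc)
  with len_inv_mult[of a e] k ka len_e have "k \<le> gromov a e" by simp
  with gromov_min[of l a e] le1[of e] l \<open>k \<noteq> 0\<close> have le: "gromov l e = 1" by simp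
  \<comment> \<open>The last \<open>k\<close> letters of \<open>b\<close> survive in
    \<open>e\<close>, so \<open>e\<close> ends in the inverse of \<open>l\<close> as well.\<close>
  have "e \<otimes> inv b = a" by (simp add: e_def m_assoc)
  with len_inv_mult[of "inv e" "inv b"] k len_e have "gromov (inv e) (inv b) = k" by simp
  with gromov_min[of l "inv b" "inv e"] le1[of "inv e"] lb \<open>k \<noteq> 0\<close>
  have lei: "gromov l (inv e) = 1" by (simp add: gromov_commute[of "inv b"])
  have len_el: "len (e \<otimes> l) + 1 = len e"
    using len_inv_mult[of "inv e" l] lei l by (simp add: gromov_commute[of "inv e"])
  \<comment> \<open>Since \<open>e\<close> has at least two letters, \<open>e \<otimes> l\<close>
    still begins with \<open>l\<close>, and conjugation shortens \<open>e\<close> at both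
    ends.\<close>
  have "inv e \<otimes> (e \<otimes> l) = l" by (simp flip: m_assoc)
  with len_inv_mult[of e "e \<otimes> l"] len_el l have "gromov e (e \<otimes> l) + 1 = len e" by simp
  with ka \<open>k \<noteq> 0\<close> len_e have "1 \<le> gromov e (e \<otimes> l)" by simp
  with gromov_min[of l e "e \<otimes> l"] le have "1 \<le> gromov l (e \<otimes> l)" by simp
  with len_inv_mult[of l "e \<otimes> l"] len_el l have conj_e: "len (inv l \<otimes> e \<otimes> l) < len e"
    by (simp add: m_assoc)
  have "generating_pair e b"
    using M by (simp add: e_def minimal_counterexample_def generating_pair_mult)
  then have "generating_pair (inv l \<otimes> e \<otimes> l) (inv l \<otimes> b \<otimes> l)"
    by (simp add: generating_pair_conj)
  moreover have "len (inv l \<otimes> e \<otimes> l) + len (inv l \<otimes> b \<otimes> l) < len a + len b"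
    using conj_b conj_e len_e by simp
  ultimately have "reversible_pair (inv l \<otimes> e \<otimes> l) (inv l \<otimes> b \<otimes> l)"
    using M by (simp add: minimal_counterexample_def)
  then have "reversible_pair a b"
    by (simp add: reversible_pair_conj_iff) (simp add: e_def reversible_pair_mult_iff)
  with M show False by (simp add: minimal_counterexample_def)
qed

text \<open>A letter loses less than half of its value to an equal neighbour and at most half to a
  letter over the other entry. Complete cancellation therefore needs exactly half on each side, and
  both neighbours over the other entry.\<close>

lemma minimal_counterexample_nielsen_reduced:
  assumes M: "minimal_counterexample a b" and "a \<noteq> \<one>" "b \<noteq> \<one>"
  shows "nielsen_reduced {a, b}"
  unfolding nielsen_reduced_def
proof (intro allI impI)
  fix s t r :: "'a \<times> bool"
  let ?v = "letter_value G"
  assume "[s, t, r] \<in> words_on {a, b} \<and> reduced [s, t, r]"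
  then have str: "fst s \<in> {a, b}" "fst t \<in> {a, b}" "fst r \<in> {a, b}"
    and st: "t \<noteq> letter_inv s" and tr: "r \<noteq> letter_inv t" by simp_all
  have ab: "c \<in> carrier G" "c \<noteq> \<one>" if "c \<in> {a, b}" for c
    using that minimal_counterexample_closed[OF M] assms(2,3) by auto
  note fst = ab(1)[OF str(1)] ab(1)[OF str(2)] ab(1)[OF str(3)] ab(2)[OF str(1)] ab(2)[OF str(2)]
  from fst have closed: "?v t \<in> carrier G" and nontriv: "?v s \<noteq> \<one>" "?v t \<noteq> \<one>"
    by (simp_all add: letter_value_def)
  have same: "2 * gromov (inv (?v p)) (?v q) < len (?v t)"
    if "q \<noteq> letter_inv p" "fst p = fst q" "t = p \<or> t = q" for p q
  proof -
    have "q = p" using that(1,2) by (auto simp: letter_inv_def prod_eq_iff)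
    with that(3) have "p = t" "q = t" by auto
    with gromov_inv_self[OF closed nontriv(2)] show ?thesis by simp
  qed
  have diff: "2 * gromov (inv (?v p)) (?v q) \<le> len (?v p) \<and>
      2 * gromov (inv (?v p)) (?v q) \<le> len (?v q)"
    if "fst p \<in> {a, b}" "fst q \<in> {a, b}" "fst p \<noteq> fst q" for p q
    using minimal_counterexample_gromov_le[OF minimal_counterexample_letters[OF M that]] by simp
  have le: "2 * gromov (inv (?v p)) (?v q) \<le> len (?v t)"
    if "q \<noteq> letter_inv p" "fst p \<in> {a, b}" "fst q \<in> {a, b}" "t = p \<or> t = q" for p q
  proof (cases "fst p = fst q")
    case True
    with same[of q p] that show ?thesis by simp
  next
    case False
    with diff[of p q] that show ?thesis by blast
  qed
  show "gromov (inv (?v s)) (?v t) + gromov (inv (?v t)) (?v r) < len (?v t)"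
  proof (rule ccontr)
    assume "\<not> ?thesis"
    with le[OF st str(1,2) disjI2[OF refl]] le[OF tr str(2,3) disjI1[OF refl]] have half: "2 * gromov (inv (?v s)) (?v t) = len (?v t)"
      "2 * gromov (inv (?v t)) (?v r) = len (?v t)" by linarith+
    with same[OF st _ disjI2[OF refl]] same[OF tr _ disjI1[OF refl]] have ne: "fst s \<noteq> fst t" "fst t \<noteq> fst r" by auto
    with str have sr: "fst s = fst r" by (metis insertE singletonD)
    show False
    proof (cases "snd s = snd r")
      case True
      \<comment> \<open>Equal neighbours: half of \<open>t\<close> cancels both in
        \<open>s t\<close> and in \<open>t s\<close>.\<close>
      with sr have "r = s" by (simp add: prod_eq_iff)
      with half minimal_counterexample_not_half[OF minimal_counterexample_letters[OF M str(1,2) ne(1)]]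
        nontriv show False by simp
    next
      case False
      \<comment> \<open>Inverse neighbours: the inverse of \<open>s\<close> shares half the length
        of \<open>t\<close> with both \<open>t\<close> and its inverse, so half of \<open>t\<close>
        would cancel in its square.\<close>
      with sr have "r = letter_inv s" by (simp add: letter_inv_def prod_eq_iff)
      then have "?v r = inv (?v s)" using fst by simp
      with half gromov_min[of "inv (?v t)" "inv (?v s)" "?v t"]
      have "len (?v t) \<le> 2 * gromov (inv (?v t)) (?v t)" by simp
      with gromov_inv_self[OF closed nontriv(2)] show False by simp
    qed
  qed
qed

end

section \<open>Generating pairs and primitive elements in rank two\<close>

locale free_group_rank_2 = free_group G "{x, y}" for G (structure) and x y +
  assumes x_neq_y: "x \<noteq> y"
begin

lemma x_closed [simp]: "x \<in> carrier G" and y_closed [simp]: "y \<in> carrier G"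
  using X_closed by auto

lemma inv_x_neq_y: "inv x \<noteq> y"
  using rword_inv[of x] rword_basis[of x] rword_basis[of y] by (auto simp: word_inv_def letter_inv_def)

text \<open>A single nontrivial \<open>g\<close> is Nielsen reduced, since its reduced words only
  repeat one letter. If it generated, both \<open>x\<close> and \<open>y\<close> would be
  \<open>g\<close> or its inverse.\<close>

lemma not_cyclic:
  assumes "g \<in> carrier G"
  shows "generate G {g} \<noteq> carrier G"
proof
  assume gen: "generate G {g} = carrier G"
  have "g \<noteq> \<one>"
  proof
    assume "g = \<one>"
    with gen have "x = \<one>" using generate_one x_closed by blast
    then have "len x = 0" by (metis len_one)
    with len_basis[of x] show False by simp
  qed
  have "nielsen_reduced {g}"
    unfolding nielsen_reduced_def
  proof (intro allI impI)
    fix s t r :: "'a \<times> bool"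
    assume "[s, t, r] \<in> words_on {g} \<and> reduced [s, t, r]"
    then have "s = t" "r = t" "fst t = g"
      by (auto simp: letter_inv_def prod_eq_iff)
    moreover from \<open>fst t = g\<close> have "letter_value G t \<in> carrier G" "letter_value G t \<noteq> \<one>"
      using assms \<open>g \<noteq> \<one>\<close> by (auto simp: letter_value_def)
    ultimately show "gromov (inv (letter_value G s)) (letter_value G t)
      + gromov (inv (letter_value G t)) (letter_value G r) < len (letter_value G t)"
      using gromov_inv_self[of "letter_value G t"] by simp
  qed
  with assms gen have "x = g \<or> inv x = g" "y = g \<or> inv y = g"
    using nielsen_reduced_generates_basis[of "{g}"] by auto
  with x_neq_y inv_x_neq_y show False
    by (metis inv_inv x_closed y_closed)
qed

lemma generating_pair_not_one:
  assumes "generating_pair a b"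
  shows "a \<noteq> \<one>"
proof
  assume "a = \<one>"
  with assms have b: "b \<in> carrier G" and "generate G {\<one>, b} = carrier G"
    by (auto simp: generating_pair_def)
  then have "generate G {b} = carrier G"
    using b by - (rule generate_eq_carrierI, auto intro: generate.one generate.incl)
  with not_cyclic[OF b] show False by simp
qed

theorem generating_pair_reversible:
  assumes "generating_pair a b"
  shows "reversible_pair a b"
  using assms
proof (induction "len a + len b" arbitrary: a b rule: less_induct)
  case less
  show ?case
  proof (rule ccontr)
    assume "\<not> reversible_pair a b"
    with less have M: "minimal_counterexample a b"
      by (auto simp: minimal_counterexample_def)
    note [simp] = minimal_counterexample_closed[OF M]
    have "a \<noteq> \<one>" "b \<noteq> \<one>"
      using generating_pair_not_one[OF less.prems]
        generating_pair_not_one[OF generating_pair_swap[OF less.prems]] by auto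
    with M have "nielsen_reduced {a, b}"
      by (rule minimal_counterexample_nielsen_reduced)
    moreover have "generate G {a, b} = carrier G"
      using less.prems by (simp add: generating_pair_def)
    ultimately have *: "z \<in> {a, b} \<or> inv z \<in> {a, b}" if "z \<in> {x, y}" for z
      using that by (intro nielsen_reduced_generates_basis) auto
    have neq: "inv y \<noteq> x" "inv x \<noteq> inv y"
      using inv_x_neq_y x_neq_y inv_inv[OF x_closed] inv_inv[OF y_closed] by metis+
    have "a = x \<or> a = inv x \<or> b = x \<or> b = inv x" "a = y \<or> a = inv y \<or> b = y \<or> b = inv y"
      using *[of x] *[of y] by auto
    \<comment> \<open>One entry cannot account for both \<open>x\<close> and \<open>y\<close>, as
      these are neither equal nor inverse to each other.\<close>
    then have "a \<in> {x, y, inv x, inv y} \<and> b \<in> {x, y, inv x, inv y}"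
      using x_neq_y inv_x_neq_y neq by (elim disjE) simp_all
    then have "reversal a = a" "reversal b = b"
      by (auto simp: reversal_basis reversal_inv)
    then have "reversible_pair a b"
      unfolding reversible_pair_def by (intro bexI[of _ \<one>]) auto
    with \<open>\<not> reversible_pair a b\<close> show False by contradiction
  qed
qed

text \<open>The parity argument, with the basis that contains \<open>w\<close> as alphabet and
  \<open>x\<close>, \<open>y\<close> as generators, bounds that basis by two elements.\<close>

lemma primitive_in_generating_pair:
  assumes "primitive G w"
  obtains b where "generating_pair w b"
proof -
  obtain B where B: "free_basis G B" "w \<in> B"
    using assms by (auto simp: primitive_def)
  interpret B: free_group G B
    by unfold_locales (rule B(1))
  have card: "card S \<le> 2" if "S \<subseteq> B" "finite S" for S
    using that generate_basis by (intro B.basis_card_le_2[of x y]) auto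
  obtain b where b: "b \<in> B" "B \<subseteq> {w, b}"
  proof (cases "B = {w}")
    \<comment> \<open>Here \<open>b\<close> is \<open>w\<close> itself, and the pair repeats its
      entry.\<close>
    case True
    with that show thesis by auto
  next
    case False
    with B(2) obtain b where b: "b \<in> B" "b \<noteq> w" by auto
    moreover have "c \<in> {w, b}" if "c \<in> B" for c
    proof (rule ccontr)
      assume "c \<notin> {w, b}"
      with b have "card {w, b, c} = 3" by auto
      with card[of "{w, b, c}"] b that B(2) show False by simp
    qed
    ultimately show thesis using that by blast
  qed
  with B(2) have "B = {w, b}" by auto
  with B.generate_basis B.X_closed have "generating_pair w b"
    by (auto simp: generating_pair_def)
  then show thesis by (rule that)
qed

end

theorem lemma1p6:
  fixes F :: "('a, 'm) monoid_scheme" and x y w :: 'a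
  assumes "group F"
    and "x \<noteq> y"
    and "free_basis F {x, y}"
    and "primitive F w"
  shows "\<exists>ps. length ps \<le> 2 \<and> (\<forall>p \<in> set ps. palindrome F {x, y} p) \<and> w = list_mult F ps"
proof -
  interpret group F by (rule assms(1))
  interpret free_group_rank_2 F x y
    by unfold_locales (use assms in auto)
  obtain b where "generating_pair w b"
    using assms(4) by (rule primitive_in_generating_pair)
  moreover from this have w [simp]: "w \<in> carrier F" by (simp add: generating_pair_def)
  ultimately obtain u where u [simp]: "u \<in> carrier F" and
    eqs: "reversal u = u" "reversal w \<otimes>\<^bsub>F\<^esub> u = u \<otimes>\<^bsub>F\<^esub> w"
    using generating_pair_reversible[of w b] by (auto simp: reversible_pair_def)
  \<comment> \<open>Reversal sends \<open>u w\<close> to \<open>reversal w\<close> times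
    \<open>u\<close>, which is \<open>u w\<close> again.\<close>
  have "palindrome F {x, y} (inv\<^bsub>F\<^esub> u)" "palindrome F {x, y} (u \<otimes>\<^bsub>F\<^esub> w)"
    by (simp_all add: palindrome_iff_reversal reversal_inv reversal_mult eqs)
  moreover have "w = list_mult F [inv\<^bsub>F\<^esub> u, u \<otimes>\<^bsub>F\<^esub> w]"
    by (simp add: list_mult_def flip: m_assoc)
  ultimately show ?thesis
    by (intro exI[of _ "[inv\<^bsub>F\<^esub> u, u \<otimes>\<^bsub>F\<^esub> w]"]) auto
qed

end
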